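(* Let $a$ and $b$ be coprime positive integers, and let $w\in S_a$ be a permutation with $k$ cycles (fixed points counted as cycles). Then the number of $(a,b)$-parking functions fixed by $w$ equals $b^{k-1}$. In particular, the number of $(a,b)$-parking functions is $|\mathsf{PF}_{a,b}|=b^{a-1}$.
   Context: An $(a,b)$-Dyck path is a lattice path from $(0,0)$ to $(b,a)$ consisting of $a$ unit north steps and $b$ unit east steps that stays weakly above the line $y=\frac{a}{b}x$. An $(a,b)$-parking function is an $(a,b)$-Dyck path together with a bijective labeling of its $a$ north steps by $\{1,2,\ldots,a\}$ such that the labels increase going north within each column (i.e. among north steps with the same $x$-coordinate). $\mathsf{PF}_{a,b}$ is the set of $(a,b)$-parking functions. The symmetric group $S_a$ acts on $\mathsf{PF}_{a,b}$ by permuting the labels and then re-sorting the labels within each column into increasing order. *)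

theory Defs
  imports Complex_Main "HOL-Combinatorics.Permutations" "HOL-Combinatorics.Orbits"
begin

datatype step = North | East

text \<open>
  A path is the list of its steps, starting at the origin; these are the coordinates
  of the lattice point reached after the first \<open>i\<close> steps.
\<close>

definition path_x :: "step list \<Rightarrow> nat \<Rightarrow> nat" where
  "path_x p i = count_list (take i p) East"

definition path_y :: "step list \<Rightarrow> nat \<Rightarrow> nat" where
  "path_y p i = count_list (take i p) North"

text \<open>
  It suffices to test the lattice points of the path against the line
  \<open>y = (a/b) x\<close>, since the region above the line is convex.
\<close>

definition dyck_path :: "nat \<Rightarrow> nat \<Rightarrow> step list \<Rightarrow> bool" where
  "dyck_path a b p \<longleftrightarrow>
     count_list p North = a \<and> count_list p East = b \<and>
     (\<forall>i\<le>length p. real (path_y p i) \<ge> real a / real b * real (path_x p i))"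

text \<open>The \<open>x\<close>-coordinates of the north steps, from the lowest to the highest.\<close>

definition north_columns :: "step list \<Rightarrow> nat list" where
  "north_columns p = map (path_x p) (filter (\<lambda>i. p ! i = North) [0..<length p])"

text \<open>
  A labelled path is a pair \<open>(p, l)\<close>, where \<open>l ! i\<close> is the label of the
  north step of \<open>p\<close> from height \<open>i\<close> to height \<open>i + 1\<close>.
\<close>

definition parking_functions :: "nat \<Rightarrow> nat \<Rightarrow> (step list \<times> nat list) set" where
  "parking_functions a b =
     {(p, l). dyck_path a b p \<and>
              length l = a \<and> bij_betw (\<lambda>i. l ! i) {..<a} {1..a} \<and>
              (\<forall>i j. i < j \<and> j < a \<and> north_columns p ! i = north_columns p ! j
                 \<longrightarrow> l ! i < l ! j)}"

definition column_labels :: "step list \<Rightarrow> nat list \<Rightarrow> nat \<Rightarrow> nat list" where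
  "column_labels p l x = map snd (filter (\<lambda>(x', _). x' = x) (zip (north_columns p) l))"

text \<open>
  Since \<open>north_columns p\<close> is weakly increasing, concatenating the sorted columns
  from left to right puts every label back into its own column.
\<close>

definition sort_columns :: "step list \<Rightarrow> nat list \<Rightarrow> nat list" where
  "sort_columns p l = concat (map (\<lambda>x. sort (column_labels p l x)) [0..<Suc (count_list p East)])"

definition parking_act :: "(nat \<Rightarrow> nat) \<Rightarrow> step list \<times> nat list \<Rightarrow> step list \<times> nat list" where
  "parking_act w = (\<lambda>(p, l). (p, sort_columns p (map w l)))"

text \<open>
  For a permutation of a finite set, the library's \<open>orbit w i\<close> is the underlying
  set of the cycle through \<open>i\<close>, which is \<open>{i}\<close> if \<open>i\<close> is a fixed point.
\<close>

definition num_cycles_on :: "nat set \<Rightarrow> (nat \<Rightarrow> nat) \<Rightarrow> nat" where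
  "num_cycles_on A w = card (orbit w ` A)"

end

theory Submission
  imports Defs "HOL-Library.Multiset" "HOL-Library.FuncSet"
begin

text \<open>
  A parking function is recorded by the map \<open>f\<close> sending each label to its column; the path
  condition becomes \<open>a x \<le> b \<bar>{i. f i < x}\<bar>\<close> for all \<open>x \<le> b\<close>, and being fixed by \<open>w\<close> means
  that \<open>f\<close> is constant on the cycles of \<open>w\<close>. The maps to \<open>\<int>/b\<close> that are constant on the
  \<open>k\<close> cycles number \<open>b^k\<close>. The cyclic group \<open>\<int>/b\<close> acts on them by translation, and by the cycle
  lemma each of its orbits has \<open>b\<close> elements, exactly one of which is a parking function: the
  translates of \<open>f\<close> that are parking functions correspond to the minima over \<open>x < b\<close> of
  \<open>b \<bar>{i. f i < x}\<bar> - a x\<close>, and these values are distinct modulo \<open>b\<close> as \<open>a\<close> and \<open>b\<close> are coprime.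
\<close>

section \<open>Paths and their column lists\<close>

lemma path_x_Cons_Suc [simp]:
  "path_x (s # p) (Suc i) = (if s = East then Suc (path_x p i) else path_x p i)"
  by (simp add: path_x_def)

lemma path_y_Cons_Suc [simp]:
  "path_y (s # p) (Suc i) = (if s = North then Suc (path_y p i) else path_y p i)"
  by (simp add: path_y_def)

lemma path_x_0 [simp]: "path_x p 0 = 0"
  by (simp add: path_x_def)

lemma path_y_0 [simp]: "path_y p 0 = 0"
  by (simp add: path_y_def)

lemma north_columns_Nil [simp]: "north_columns [] = []"
  by (simp add: north_columns_def)

lemma north_columns_Cons [simp]:
  "north_columns (s # p) =
     (if s = North then 0 # north_columns p else map Suc (north_columns p))"
proof -
  have "[0..<length (s # p)] = 0 # map Suc [0..<length p]"
    by (simp add: upt_conv_Cons map_Suc_upt del: upt_Suc)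
  then show ?thesis
    by (cases s) (simp_all add: north_columns_def filter_map o_def del: upt_Suc)
qed

lemma length_north_columns: "length (north_columns p) = count_list p North"
  by (induction p) auto

lemma sorted_north_columns: "sorted (north_columns p)"
proof (induction p)
  case (Cons s p)
  then show ?case
    by (simp add: sorted_map_same sorted_wrt_map)
qed simp

lemma north_columns_le: "x \<in> set (north_columns p) \<Longrightarrow> x \<le> count_list p East"
proof (induction p arbitrary: x)
  case (Cons s p)
  then show ?case by (cases s) auto
qed simp

text \<open>The columns of the north steps leave open only how many east steps follow the last north
  step, and the number of east steps settles this.\<close>

lemma north_columns_inject:
  assumes "north_columns p = north_columns q" "count_list p East = count_list q East"
  shows "p = q"
  using assms
proof (induction p arbitrary: q)
  case Nil
  then show ?case by (cases q; cases "hd q") (auto split: if_splits)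
next
  case (Cons s p)
  show ?case
  proof (cases q)
    case Nil
    with Cons.prems show ?thesis by (cases s) auto
  next
    case (Cons t r)
    then show ?thesis
      using Cons.prems Cons.IH[of r]
      by (cases s; cases t) auto
  qed
qed

text \<open>The path is built from its start: a leading 0 is a north step; otherwise all entries are
  positive, and an east step lowers them and \<open>n\<close> by 1. Either way
  \<open>length xs + n\<close> drops.\<close>

lemma ex_north_columns:
  assumes "sorted xs" "\<forall>x\<in>set xs. x \<le> n"
  shows "\<exists>p. north_columns p = xs \<and> count_list p East = n"
  using assms
proof (induction "length xs + n" arbitrary: xs n rule: less_induct)
  case less
  show ?case
  proof (cases "xs \<noteq> [] \<and> hd xs = 0")
    case True
    then obtain ys where ys: "xs = 0 # ys" by (cases xs) auto
    with less.prems less.hyps[of ys n] obtain p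
      where "north_columns p = ys" "count_list p East = n" by auto
    with ys show ?thesis by (intro exI[of _ "North # p"]) auto
  next
    case False
    have pos: "x > 0" if "x \<in> set xs" for x
      using False that less.prems(1) by (cases xs) auto
    show ?thesis
    proof (cases n)
      case 0
      with pos less.prems(2) have "xs = []" by (cases xs) auto
      with 0 show ?thesis by (intro exI[of _ "[]"]) auto
    next
      case (Suc m)
      define ys where "ys = map (\<lambda>x. x - 1) xs"
      have xs: "xs = map Suc ys"
        using pos by (auto simp: ys_def o_def intro!: map_idI[symmetric])
      have "sorted ys" using less.prems(1) by (simp add: xs sorted_wrt_map)
      moreover have "\<forall>x\<in>set ys. x \<le> m" using less.prems(2) Suc by (auto simp: xs)
      ultimately obtain p where "north_columns p = ys" "count_list p East = m"
        using less.hyps[of ys m] Suc by (auto simp: xs)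
      with xs Suc show ?thesis by (intro exI[of _ "East # p"]) auto
    qed
  qed
qed

text \<open>North steps in columns left of the current point have all been taken. Equality may fail
  because the current column can already be partly climbed.\<close>

lemma columns_less_path_x_le_path_y:
  assumes "i \<le> length p"
  shows "length (filter (\<lambda>c. c < path_x p i) (north_columns p)) \<le> path_y p i"
  using assms
proof (induction p arbitrary: i)
  case (Cons s p)
  then show ?case by (cases i; cases s) (fastforce simp: filter_map o_def)+
qed simp

text \<open>The witness is the lowest point of the path with abscissa \<open>x\<close>: no north
  step of column \<open>x\<close> has been taken there, so the bound of
  \<open>columns_less_path_x_le_path_y\<close> is attained.\<close>

lemma ex_path_x_eq:
  assumes "x \<le> count_list p East"
  shows "\<exists>i\<le>length p. path_x p i = x \<and>
           path_y p i = length (filter (\<lambda>c. c < x) (north_columns p))"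
  using assms
proof (induction p arbitrary: x)
  case (Cons s p)
  show ?case
  proof (cases x)
    case 0
    then show ?thesis by (intro exI[of _ 0]) auto
  next
    case (Suc y)
    obtain i where "i \<le> length p" "path_x p i = (if s = East then y else x)"
      "path_y p i = length (filter (\<lambda>c. c < (if s = East then y else x)) (north_columns p))"
      using Cons.IH[of "if s = East then y else x"] Cons.prems Suc by (cases s) auto
    then show ?thesis
      using Suc by (intro exI[of _ "Suc i"], cases s) (auto simp: filter_map o_def)
  qed
qed auto

text \<open>Within a column the condition is tightest at the lowest point, whose height is the
  number of north steps further left. So one inequality per column suffices.\<close>

lemma dyck_path_iff:
  assumes "b > 0"
  shows "dyck_path a b p \<longleftrightarrow> count_list p North = a \<and> count_list p East = b \<and>
           (\<forall>x\<le>b. a * x \<le> b * length (filter (\<lambda>c. c < x) (north_columns p)))"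
proof -
  have 1: "real a / real b * real x \<le> real y \<longleftrightarrow> a * x \<le> b * y" for x y
  proof -
    have "real a / real b * real x \<le> real y \<longleftrightarrow> real (a * x) \<le> real (b * y)"
      using assms by (simp add: field_simps)
    then show ?thesis by linarith
  qed
  have "(\<forall>i\<le>length p. a * path_x p i \<le> b * path_y p i) \<longleftrightarrow>
        (\<forall>x\<le>b. a * x \<le> b * length (filter (\<lambda>c. c < x) (north_columns p)))" (is "?L \<longleftrightarrow> ?R")
    if "count_list p East = b"
  proof
    assume ?L
    then show ?R using ex_path_x_eq[of _ p] that by metis
  next
    assume R: ?R
    show ?L
    proof (intro allI impI)
      fix i assume i: "i \<le> length p"
      have "count_list (take i p) East \<le> count_list (take i p @ drop i p) East"
        unfolding count_list_append by simp
      then have "path_x p i \<le> b"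
        using that by (simp add: path_x_def)
      with R have "a * path_x p i \<le>
          b * length (filter (\<lambda>c. c < path_x p i) (north_columns p))" by blast
      also have "\<dots> \<le> b * path_y p i"
        using columns_less_path_x_le_path_y[OF i] by simp
      finally show "a * path_x p i \<le> b * path_y p i" .
    qed
  qed
  then show ?thesis unfolding dyck_path_def 1 by blast
qed

section \<open>Sorting by columns\<close>

text \<open>This is bucket sort. It is stable, and stability together with sortedness by key
  determines the result uniquely (\<open>properties_for_sort_key\<close>).\<close>

lemma concat_filter_eq_sort_key:
  fixes f :: "'a \<Rightarrow> nat"
  shows "concat (map (\<lambda>x. filter (\<lambda>i. f i = x) xs) [0..<n]) =
           sort_key f (filter (\<lambda>i. f i < n) xs)"
proof (induction n)
  case (Suc n)
  have "sort_key f (filter (\<lambda>i. f i < Suc n) xs) =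
          sort_key f (filter (\<lambda>i. f i < n) xs) @ filter (\<lambda>i. f i = n) xs"
  proof (rule properties_for_sort_key)
    show "mset (sort_key f (filter (\<lambda>i. f i < n) xs) @ filter (\<lambda>i. f i = n) xs) =
            mset (filter (\<lambda>i. f i < Suc n) xs)"
      by (induction xs) (auto simp: less_Suc_eq)
    show "filter (\<lambda>y. f k = f y) (sort_key f (filter (\<lambda>i. f i < n) xs) @ filter (\<lambda>i. f i = n) xs)
            = filter (\<lambda>y. f k = f y) (filter (\<lambda>i. f i < Suc n) xs)" for k
      by (cases "f k < n"; cases "f k = n")
         (auto simp: filter_empty_conv sort_key_stable eq_commute[of "f k"] intro!: filter_cong)
    show "sorted (map f (sort_key f (filter (\<lambda>i. f i < n) xs) @ filter (\<lambda>i. f i = n) xs))"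
      by (auto simp: sorted_append sorted_map_same[of f "\<lambda>_. n", simplified])
  qed
  with Suc show ?case by simp
qed simp

lemma sort_key_cong:
  assumes "\<And>x. x \<in> set xs \<Longrightarrow> g x = f x"
  shows "sort_key g xs = sort_key f xs"
proof (rule properties_for_sort_key)
  have "map g (sort_key f xs) = map f (sort_key f xs)" using assms by simp
  from this[symmetric] show "sorted (map g (sort_key f xs))"
    using sorted_sort_key by metis
  fix k assume "k \<in> set (sort_key f xs)"
  then have "g k = f k" using assms by simp
  then have "filter (\<lambda>y. g k = g y) ys = filter (\<lambda>y. f y = f k) ys" if "set ys = set xs" for ys
    using assms that by (intro filter_cong) auto
  from this[of "sort_key f xs"] this[of xs]
  show "filter (\<lambda>y. g k = g y) (sort_key f xs) = filter (\<lambda>y. g k = g y) xs"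
    by (simp add: sort_key_stable)
qed simp

lemma sort_enumeration:
  assumes "distinct l" "set l = {1..a}"
  shows "sort l = sorted_list_of_set {1..a}"
  using assms by (metis distinct_remdups_id sorted_list_of_set_sort_remdups)

lemma column_labels_eq_filter:
  assumes "map f l = north_columns p"
  shows "column_labels p l x = filter (\<lambda>i. f i = x) l"
  unfolding column_labels_def assms[symmetric]
  by (induction l) auto

text \<open>A normal form: after re-sorting, the labels depend only on which column each label lies
  in, not on the order in \<open>l\<close>. Column by column, the result is the bucket sort of the
  increasing list of labels.\<close>

lemma sort_columns_eq_sort_key:
  assumes "distinct l" "set l = {1..a}" "map f l = north_columns p"
  shows "sort_columns p l = sort_key f (sorted_list_of_set {1..a})"
proof -
  have "f i < Suc (count_list p East)" if "i \<in> {1..a}" for i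
    using north_columns_le[of "f i" p] that assms(2) assms(3)[symmetric] by (auto simp: less_Suc_eq_le)
  then have *: "filter (\<lambda>i. f i < Suc (count_list p East)) (sorted_list_of_set {1..a}) = sorted_list_of_set {1..a}"
    by auto
  have "sort (column_labels p l x) = filter (\<lambda>i. f i = x) (sorted_list_of_set {1..a})" for x
    unfolding column_labels_eq_filter[OF assms(3)] filter_sort[symmetric]
      sort_enumeration[OF assms(1,2)] ..
  then show ?thesis
    unfolding sort_columns_def by (simp only: concat_filter_eq_sort_key *)
qed

lemma bij_betw_nth_iff:
  assumes "length l = a"
  shows "bij_betw (\<lambda>i. l ! i) {..<a} {1..a} \<longleftrightarrow> distinct l \<and> set l = {1..a}"
proof -
  have "set l = (!) l ` {..<a}" using assms by (auto simp: set_conv_nth)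
  moreover have "distinct l \<longleftrightarrow> inj_on ((!) l) {..<a}"
    using assms by (auto simp: distinct_conv_nth inj_on_def)
  ultimately show ?thesis by (auto simp: bij_betw_def)
qed

text \<open>A stable sort by column keeps the labels of each column in their increasing input order;
  conversely, uniqueness of the stable sort identifies any column-sorted list of labels with this
  property.\<close>

lemma sort_key_labels_iff:
  fixes f :: "nat \<Rightarrow> nat"
  assumes "distinct l" "set l = {1..a}" "length l = a" "sorted (map f l)"
  shows "(\<forall>i j. i < j \<and> j < a \<and> f (l ! i) = f (l ! j) \<longrightarrow> l ! i < l ! j) \<longleftrightarrow>
           l = sort_key f (sorted_list_of_set {1..a})"
proof
  assume L: "\<forall>i j. i < j \<and> j < a \<and> f (l ! i) = f (l ! j) \<longrightarrow> l ! i < l ! j"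
  have "sort_key f (sorted_list_of_set {1..a}) = l"
  proof (rule properties_for_sort_key)
    show "mset l = mset (sorted_list_of_set {1..a})"
      using sort_enumeration[OF assms(1,2)] by (metis mset_sort)
    show "sorted (map f l)" by fact
    fix k
    have "sorted_wrt (\<lambda>x y. f x = f y \<longrightarrow> x < y) l"
      unfolding sorted_wrt_iff_nth_less using L assms(3) by auto
    then have "sorted (filter (\<lambda>y. f k = f y) l)"
      by (induction l) (auto intro: less_imp_le)
    then have "filter (\<lambda>y. f k = f y) l = sort (filter (\<lambda>y. f k = f y) l)"
      by (simp add: sorted_sort_id)
    also have "\<dots> = filter (\<lambda>y. f k = f y) (sorted_list_of_set {1..a})"
      unfolding filter_sort[symmetric] sort_enumeration[OF assms(1,2)] ..
    finally show "filter (\<lambda>y. f k = f y) l = filter (\<lambda>y. f k = f y) (sorted_list_of_set {1..a})" .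
  qed
  then show "l = sort_key f (sorted_list_of_set {1..a})" ..
next
  assume R: "l = sort_key f (sorted_list_of_set {1..a})"
  show "\<forall>i j. i < j \<and> j < a \<and> f (l ! i) = f (l ! j) \<longrightarrow> l ! i < l ! j"
  proof (intro allI impI)
    fix i j assume ij: "i < j \<and> j < a \<and> f (l ! i) = f (l ! j)"
    define k where "k = f (l ! i)"
    have "filter (\<lambda>y. f y = k) l = filter (\<lambda>y. f y = k) (sorted_list_of_set {1..a})"
      using R by (simp only: sort_key_stable)
    then have s: "sorted_wrt (<) (filter (\<lambda>y. f y = k) l)"
      by (simp only: sorted_wrt_filter strict_sorted_list_of_set)
    have "l = take j l @ l ! j # drop (Suc j) l"
      using ij assms(3) by (simp add: id_take_nth_drop)
    then have "filter (\<lambda>y. f y = k) l =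
        filter (\<lambda>y. f y = k) (take j l) @ l ! j # filter (\<lambda>y. f y = k) (drop (Suc j) l)"
      using ij unfolding k_def by (metis (mono_tags, lifting) filter.simps(2) filter_append)
    moreover have "l ! i \<in> set (filter (\<lambda>y. f y = k) (take j l))"
      using ij assms(3) by (auto simp: k_def in_set_conv_nth)
    ultimately show "l ! i < l ! j"
      using s by (auto simp: sorted_wrt_append)
  qed
qed

section \<open>Column functions\<close>

text \<open>The restriction makes the function extensional, so that a parking function has exactly
  one column function and these can be counted inside \<open>\<rightarrow>\<^sub>E\<close>.\<close>

definition column_fun :: "nat \<Rightarrow> step list \<times> nat list \<Rightarrow> nat \<Rightarrow> nat" where
  "column_fun a = (\<lambda>(p, l). restrict (\<lambda>i. the (map_of (zip l (north_columns p)) i)) {1..a})"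

text \<open>Columns range over \<open>{..<b}\<close>, although paths also reach abscissa
  \<open>b\<close>: the condition at \<open>x = b\<close> puts all north steps left of it. Columns
  can thus be read as residues modulo \<open>b\<close>.\<close>

definition parking_funs :: "nat \<Rightarrow> nat \<Rightarrow> (nat \<Rightarrow> nat) set" where
  "parking_funs a b =
     {f \<in> {1..a} \<rightarrow>\<^sub>E {..<b}. \<forall>x\<le>b. a * x \<le> b * card {i \<in> {1..a}. f i < x}}"

lemma map_column_fun:
  assumes "distinct l" "set l = {1..a}" "length (north_columns p) = length l"
  shows "map (column_fun a (p, l)) l = north_columns p"
  using assms nth_mem[of _ l]
  by (intro nth_equalityI) (auto simp: column_fun_def map_of_zip_nth)

lemma column_fun_eqI:
  assumes "distinct l" "set l = {1..a}" "map f l = north_columns p" "f \<in> extensional {1..a}"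
  shows "column_fun a (p, l) = f"
proof (rule extensionalityI[of _ "{1..a}"])
  have "length (north_columns p) = length l" using assms(3) by (metis length_map)
  then have "map (column_fun a (p, l)) l = map f l"
    using map_column_fun[of l a p] assms by simp
  then show "column_fun a (p, l) i = f i" if "i \<in> {1..a}" for i
    using that assms(2) by simp
qed (use assms in \<open>auto simp: column_fun_def\<close>)

lemma length_filter_map_eq_card:
  assumes "distinct l" "set l = A"
  shows "length (filter P (map f l)) = card {i \<in> A. P (f i)}"
proof -
  have "length (filter P (map f l)) = length (filter (P \<circ> f) l)" by (simp add: filter_map)
  also have "\<dots> = card (set (filter (P \<circ> f) l))"
    using assms(1) by (simp only: distinct_card distinct_filter)
  finally show ?thesis using assms(2) by simp
qed

text \<open>The bridge between both descriptions: \<open>f\<close> yields the labels by a stable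
  sort, and the path by its list of columns.\<close>

lemma parking_functions_iff:
  assumes "b > 0"
  shows "(p, l) \<in> parking_functions a b \<longleftrightarrow>
     count_list p East = b \<and> length l = a \<and> distinct l \<and> set l = {1..a} \<and>
     (\<exists>f\<in>parking_funs a b. map f l = north_columns p \<and> l = sort_key f (sorted_list_of_set {1..a}))"
    (is "?L \<longleftrightarrow> ?R")
proof
  assume L: ?L
  define f where "f = column_fun a (p, l)"
  from L have "length l = a" and "bij_betw (\<lambda>i. l ! i) {..<a} {1..a}"
    and d: "dyck_path a b p"
    by (simp_all add: parking_functions_def)
  with bij_betw_nth_iff have l: "length l = a" "distinct l" "set l = {1..a}" by blast+
  from d have p: "count_list p East = b" "count_list p North = a"
    by (auto simp: dyck_path_def)
  have N: "map f l = north_columns p"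
    unfolding f_def using l p by (intro map_column_fun) (auto simp: length_north_columns)
  have park: "a * x \<le> b * card {i \<in> {1..a}. f i < x}" if "x \<le> b" for x
    using d that unfolding dyck_path_iff[OF assms] N[symmetric] length_filter_map_eq_card[OF l(2,3)]
    by blast
  \<comment> \<open>At \<open>x = b\<close> the condition reads
    \<open>a * b \<le> b * card ...\<close>, which forces every label into a column below
    \<open>b\<close>.\<close>
  have "card {i \<in> {1..a}. f i < b} \<ge> card {1..a}" using park[of b] assms by simp
  then have "{i \<in> {1..a}. f i < b} = {1..a}" by (intro card_seteq) auto
  then have "f i < b" if "i \<in> {1..a}" for i using that by blast
  moreover have "f \<in> extensional {1..a}" by (simp add: f_def column_fun_def)
  ultimately have "f \<in> {1..a} \<rightarrow>\<^sub>E {..<b}" by (simp add: PiE_def)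
  with park have "f \<in> parking_funs a b" by (auto simp: parking_funs_def)
  moreover have "l = sort_key f (sorted_list_of_set {1..a})"
  proof (subst sort_key_labels_iff[symmetric])
    show "\<forall>i j. i < j \<and> j < a \<and> f (l ! i) = f (l ! j) \<longrightarrow> l ! i < l ! j"
      using L l by (auto simp: parking_functions_def N[symmetric])
  qed (use l in \<open>simp_all add: N sorted_north_columns\<close>)
  ultimately show ?R using p l N by blast
next
  assume R: ?R
  then obtain f where f: "f \<in> parking_funs a b" "map f l = north_columns p"
    "l = sort_key f (sorted_list_of_set {1..a})"
    and l: "length l = a" "distinct l" "set l = {1..a}" and p: "count_list p East = b" by blast
  have "dyck_path a b p"
    unfolding dyck_path_iff[OF assms] f(2)[symmetric] length_filter_map_eq_card[OF l(2,3)]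
    using f(1) l(1) p arg_cong[OF f(2), of length] by (simp add: length_north_columns parking_funs_def)
  moreover have "\<forall>i j. i < j \<and> j < a \<and> f (l ! i) = f (l ! j) \<longrightarrow> l ! i < l ! j"
    by (subst sort_key_labels_iff) (use l f(3) in \<open>simp_all add: f(2) sorted_north_columns\<close>)
  moreover have "bij_betw (\<lambda>i. l ! i) {..<a} {1..a}" using bij_betw_nth_iff l by blast
  ultimately show ?L
    using l by (auto simp: parking_functions_def f(2)[symmetric])
qed

lemma parking_act_fixed_iff:
  assumes "w permutes {1..a}" "distinct l" "set l = {1..a}" "map f l = north_columns p"
    "l = sort_key f (sorted_list_of_set {1..a})"
  shows "parking_act w (p, l) = (p, l) \<longleftrightarrow> (\<forall>i\<in>{1..a}. f (w i) = f i)"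
proof -
  \<comment> \<open>Label \<open>w i\<close> takes the place of label \<open>i\<close>, so
    \<open>g\<close> is the column function after the action.\<close>
  define g where "g = f \<circ> inv w"
  have wl: "distinct (map w l)" "set (map w l) = {1..a}"
    using assms by (auto simp: distinct_map permutes_image permutes_inj_on)
  have "map g (map w l) = north_columns p"
    using assms(1) by (simp add: g_def permutes_inverses(2) assms(4)[symmetric])
  from sort_columns_eq_sort_key[OF wl this]
  have act: "parking_act w (p, l) = (p, sort_key g (sorted_list_of_set {1..a}))"
    by (simp add: parking_act_def)
  have iff: "(\<forall>i\<in>{1..a}. g i = f i) \<longleftrightarrow> (\<forall>i\<in>{1..a}. f (w i) = f i)"
  proof
    assume "\<forall>i\<in>{1..a}. g i = f i"
    then show "\<forall>i\<in>{1..a}. f (w i) = f i"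
      using assms(1) permutes_in_image[OF assms(1)] by (metis comp_apply g_def permutes_inverses(2))
  next
    assume "\<forall>i\<in>{1..a}. f (w i) = f i"
    then show "\<forall>i\<in>{1..a}. g i = f i"
      using permutes_in_image[OF permutes_inv[OF assms(1)]]
      by (metis assms(1) comp_apply g_def permutes_inverses(1))
  qed
  have "sort_key g (sorted_list_of_set {1..a}) = l \<longleftrightarrow> (\<forall>i\<in>{1..a}. g i = f i)"
  proof
    assume gl: "sort_key g (sorted_list_of_set {1..a}) = l"
    \<comment> \<open>Since \<open>w\<close> permutes the labels, \<open>g\<close> takes the same
      multiset of values as \<open>f\<close>. Listed along \<open>l\<close>, both are sorted, hence
      they agree entry by entry.\<close>
    have "mset (map w l) = mset l"
      using wl assms(2,3) set_eq_iff_mset_eq_distinct by metis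
    then have "image_mset g (mset (map w l)) = image_mset g (mset l)" by simp
    moreover have "image_mset g (mset (map w l)) = mset (map f l)"
      using assms(1) by (simp add: g_def permutes_inverses(2) image_mset.compositionality o_def)
    ultimately have "mset (map g l) = mset (map f l)" by simp
    moreover have "sorted (map g l)" using gl by (metis sorted_sort_key)
    moreover have "sorted (map f l)" by (simp add: assms(4) sorted_north_columns)
    ultimately have "map g l = map f l"
      by (metis properties_for_sort)
    then show "\<forall>i\<in>{1..a}. g i = f i" using assms(3) by simp
  next
    assume "\<forall>i\<in>{1..a}. g i = f i"
    then have "sort_key g (sorted_list_of_set {1..a}) = sort_key f (sorted_list_of_set {1..a})"
      by (intro sort_key_cong) auto
    then show "sort_key g (sorted_list_of_set {1..a}) = l" using assms(5) by simp
  qed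
  with iff act show ?thesis by auto
qed

lemma card_fixed_parking_functions:
  assumes "b > 0" "w permutes {1..a}"
  shows "card {P \<in> parking_functions a b. parking_act w P = P} =
         card {f \<in> parking_funs a b. \<forall>i\<in>{1..a}. f (w i) = f i}"
proof (rule bij_betw_same_card, rule bij_betwI'[of _ "column_fun a"])
  fix P assume P: "P \<in> {P \<in> parking_functions a b. parking_act w P = P}"
  obtain p l where P_eq: "P = (p, l)" by fastforce
  with P have "(p, l) \<in> parking_functions a b" by blast
  then obtain f where f: "f \<in> parking_funs a b" "map f l = north_columns p"
    "l = sort_key f (sorted_list_of_set {1..a})" and l: "distinct l" "set l = {1..a}"
    unfolding parking_functions_iff[OF assms(1)] by blast
  then have "column_fun a P = f"
    unfolding P_eq by (intro column_fun_eqI) (auto simp: parking_funs_def PiE_def)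
  with f show "column_fun a P \<in> {f \<in> parking_funs a b. \<forall>i\<in>{1..a}. f (w i) = f i}"
    using P parking_act_fixed_iff[OF assms(2) l f(2,3)] P_eq by auto
next
  fix P Q assume "P \<in> {P \<in> parking_functions a b. parking_act w P = P}"
    and "Q \<in> {P \<in> parking_functions a b. parking_act w P = P}"
  moreover obtain p l q m where PQ: "P = (p, l)" "Q = (q, m)" by (meson surj_pair)
  ultimately have "(p, l) \<in> parking_functions a b" "(q, m) \<in> parking_functions a b" by blast+
  then obtain f g where
      f: "f \<in> parking_funs a b" "map f l = north_columns p" "l = sort_key f (sorted_list_of_set {1..a})"
    and g: "g \<in> parking_funs a b" "map g m = north_columns q" "m = sort_key g (sorted_list_of_set {1..a})"
    and l: "distinct l" "set l = {1..a}" and m: "distinct m" "set m = {1..a}"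
    and E: "count_list p East = b" "count_list q East = b"
    unfolding parking_functions_iff[OF assms(1)] by blast
  have "column_fun a P = f" "column_fun a Q = g"
    unfolding PQ using f g l m by (auto intro!: column_fun_eqI simp: parking_funs_def PiE_def)
  then show "column_fun a P = column_fun a Q \<longleftrightarrow> P = Q"
    using f(2,3) g(2,3) E north_columns_inject[of p q] unfolding PQ by metis
next
  fix f assume f: "f \<in> {f \<in> parking_funs a b. \<forall>i\<in>{1..a}. f (w i) = f i}"
  define l where "l = sort_key f (sorted_list_of_set {1..a})"
  have l: "length l = a" "distinct l" "set l = {1..a}"
    by (simp_all add: l_def)
  have "sorted (map f l)" by (simp add: l_def)
  moreover have "\<forall>x\<in>set (map f l). x \<le> b"
    using f l by (auto simp: parking_funs_def dest!: PiE_mem intro: less_imp_le)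
  ultimately obtain p where p: "map f l = north_columns p" "count_list p East = b"
    using ex_north_columns by metis
  have "(p, l) \<in> parking_functions a b"
    unfolding parking_functions_iff[OF assms(1)] using f l p l_def by blast
  moreover have "parking_act w (p, l) = (p, l)"
    using parking_act_fixed_iff[OF assms(2) l(2,3) p(1) l_def] f by blast
  moreover have "column_fun a (p, l) = f"
    using f l p by (intro column_fun_eqI) (auto simp: parking_funs_def PiE_def)
  ultimately show "\<exists>P\<in>{P \<in> parking_functions a b. parking_act w P = P}. f = column_fun a P"
    by blast
qed

section \<open>The cycle lemma\<close>

text \<open>In natural numbers, subtracting \<open>m\<close> modulo \<open>b\<close> is translation
  by \<open>b - m\<close>; this is the form used below.\<close>

definition translate :: "nat \<Rightarrow> nat \<Rightarrow> nat \<Rightarrow> (nat \<Rightarrow> nat) \<Rightarrow> nat \<Rightarrow> nat" where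
  "translate a b m f = restrict (\<lambda>i. (f i + m) mod b) {1..a}"

text \<open>This is \<open>b\<close> times the signed vertical distance from the diagonal up to the
  lowest point of column \<open>x\<close>. It is an integer because an arbitrary \<open>f\<close>
  may go below the diagonal.\<close>

definition excess :: "nat \<Rightarrow> nat \<Rightarrow> (nat \<Rightarrow> nat) \<Rightarrow> nat \<Rightarrow> int" where
  "excess a b f x = int (b * card {i \<in> {1..a}. f i < x}) - int (a * x)"

lemma translate_PiE: "b > 0 \<Longrightarrow> translate a b m f \<in> {1..a} \<rightarrow>\<^sub>E {..<b}"
  by (auto simp: translate_def)

lemma translate_translate:
  assumes "f \<in> {1..a} \<rightarrow>\<^sub>E {..<b}" "m + n = b"
  shows "translate a b n (translate a b m f) = f"
proof (rule extensionalityI[of _ "{1..a}"])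
  fix i assume "i \<in> {1..a}"
  with assms have "f i < b" by auto
  have "((f i + m) mod b + n) mod b = (f i + (m + n)) mod b" by (simp add: mod_simps add.assoc)
  with \<open>f i < b\<close> \<open>i \<in> {1..a}\<close> assms show "translate a b n (translate a b m f) i = f i"
    by (simp add: translate_def)
qed (use assms in \<open>auto simp: translate_def PiE_def\<close>)

lemma excess_0 [simp]: "excess a b f 0 = 0"
  by (simp add: excess_def)

lemma excess_top:
  assumes "f \<in> {1..a} \<rightarrow>\<^sub>E {..<b}"
  shows "excess a b f b = 0"
proof -
  have "{i \<in> {1..a}. f i < b} = {1..a}" using assms by auto
  then show ?thesis by (simp add: excess_def)
qed

text \<open>Translation by \<open>b - m\<close> makes column \<open>m\<close> the first one, so
  excesses are read cyclically from there, relative to the value at \<open>m\<close>. Wrapping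
  around adds nothing, as the excess at \<open>b\<close> is 0.\<close>

lemma excess_translate:
  assumes f: "f \<in> {1..a} \<rightarrow>\<^sub>E {..<b}" and m: "m < b" and x: "x \<le> b"
  shows "excess a b (translate a b (b - m) f) x =
           excess a b f (if x + m \<le> b then x + m else x + m - b) - excess a b f m"
proof -
  define C where "C y = {i \<in> {1..a}. f i < y}" for y
  define g where "g = translate a b (b - m) f"
  have g: "g i = (if m \<le> f i then f i - m else f i + b - m)" and fb: "f i < b"
    if "i \<in> {1..a}" for i
  proof -
    show fb: "f i < b" using f that by auto
    show "g i = (if m \<le> f i then f i - m else f i + b - m)"
    proof (cases "m \<le> f i")
      case True
      then have "f i + (b - m) = (f i - m) + b" using m by simp
      then have "(f i + (b - m)) mod b = (f i - m) mod b" by (simp only: mod_add_self2)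
      also have "\<dots> = f i - m" using fb by simp
      finally have "(f i + (b - m)) mod b = f i - m" .
      with True show ?thesis using that by (simp add: g_def translate_def)
    next
      case False
      then have "(f i + (b - m)) mod b = f i + b - m" using m by simp
      with False show ?thesis using that by (simp add: g_def translate_def)
    qed
  qed
  have fin [simp]: "finite (C y)" for y by (simp add: C_def)
  show ?thesis
  proof (cases "x + m \<le> b")
    case True
    have "{i \<in> {1..a}. g i < x} = C (x + m) - C m"
      using g True fb by (auto simp: C_def split: if_splits)
    moreover have "C m \<subseteq> C (x + m)" by (auto simp: C_def)
    ultimately have "int (card {i \<in> {1..a}. g i < x}) = int (card (C (x + m))) - int (card (C m))"
      by (simp add: card_Diff_subset card_mono of_nat_diff)
    then have "int (b * card {i \<in> {1..a}. g i < x}) =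
        int b * int (card (C (x + m))) - int b * int (card (C m))"
      by (simp add: right_diff_distrib)
    with True show ?thesis
      by (simp add: excess_def C_def g_def algebra_simps)
  next
    case False
    \<comment> \<open>The first \<open>x\<close> new columns are the old ones from \<open>m\<close>
      to the end and, past the wrap, the old ones below \<open>x + m - b\<close>, which is at most
      \<open>m\<close>.\<close>
    have "{i \<in> {1..a}. g i < x} = ({1..a} - C m) \<union> C (x + m - b)"
    proof (rule set_eqI)
      show "i \<in> {i \<in> {1..a}. g i < x} \<longleftrightarrow> i \<in> ({1..a} - C m) \<union> C (x + m - b)" for i
        using g[of i] fb[of i] False x m by (cases "i \<in> {1..a}") (auto simp: C_def)
    qed
    moreover have "({1..a} - C m) \<inter> C (x + m - b) = {}" using x m by (auto simp: C_def)
    moreover have "C m \<subseteq> {1..a}" by (auto simp: C_def)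
    moreover from this have "card (C m) \<le> a" using card_mono[of "{1..a}" "C m"] by simp
    ultimately have "int (card {i \<in> {1..a}. g i < x}) =
        int a - int (card (C m)) + int (card (C (x + m - b)))"
      by (simp add: card_Un_disjoint card_Diff_subset of_nat_diff)
    then have "int (b * card {i \<in> {1..a}. g i < x}) =
        int b * int a - int b * int (card (C m)) + int b * int (card (C (x + m - b)))"
      by (simp only: of_nat_mult distrib_left right_diff_distrib)
    moreover have "int (a * (x + m - b)) = int a * int x + int a * int m - int b * int a"
      using False by (simp add: of_nat_diff distrib_left right_diff_distrib)
    ultimately show ?thesis using False
      unfolding excess_def C_def g_def by simp
  qed
qed

lemma parking_funs_iff_excess:
  "f \<in> parking_funs a b \<longleftrightarrow> f \<in> {1..a} \<rightarrow>\<^sub>E {..<b} \<and> (\<forall>x\<le>b. 0 \<le> excess a b f x)"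
  by (simp add: parking_funs_def excess_def del: of_nat_mult)

text \<open>By \<open>excess_translate\<close>, the excesses of the translate are the differences to
  the excess of \<open>f\<close> at \<open>m\<close>; they are nonnegative exactly when
  \<open>m\<close> is a minimum.\<close>

lemma translate_parking_iff:
  assumes f: "f \<in> {1..a} \<rightarrow>\<^sub>E {..<b}" and m: "m < b"
  shows "translate a b (b - m) f \<in> parking_funs a b \<longleftrightarrow>
           (\<forall>y<b. excess a b f m \<le> excess a b f y)"
proof
  assume L: "translate a b (b - m) f \<in> parking_funs a b"
  show "\<forall>y<b. excess a b f m \<le> excess a b f y"
  proof (intro allI impI)
    fix y assume y: "y < b"
    \<comment> \<open>\<open>x\<close> is the new position of column \<open>y\<close>. If
      \<open>x + m = b\<close>, then \<open>y = 0\<close> and the formula evaluates at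
      \<open>b\<close> instead of 0; both excesses vanish.\<close>
    define x where "x = (if m \<le> y then y - m else y + b - m)"
    have "x \<le> b" "(if x + m \<le> b then x + m else x + m - b) = (if x + m = b then b else y)"
         "x + m = b \<Longrightarrow> y = 0"
      using y m by (auto simp: x_def split: if_splits)
    then have "excess a b f (if x + m \<le> b then x + m else x + m - b) = excess a b f y"
      using excess_top[OF f] by auto
    moreover have "0 \<le> excess a b (translate a b (b - m) f) x"
      using L \<open>x \<le> b\<close> by (simp add: parking_funs_iff_excess)
    ultimately show "excess a b f m \<le> excess a b f y"
      using excess_translate[OF f m \<open>x \<le> b\<close>] by simp
  qed
next
  assume R: "\<forall>y<b. excess a b f m \<le> excess a b f y"
  have R': "excess a b f m \<le> excess a b f y" if "y \<le> b" for y
    using R[rule_format, of y] R[rule_format, of 0] that m excess_top[OF f] by (cases "y = b") auto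
  have "0 \<le> excess a b (translate a b (b - m) f) x" if "x \<le> b" for x
    unfolding excess_translate[OF f m that] using that m
    by (simp add: R')
  then show "translate a b (b - m) f \<in> parking_funs a b"
    using m translate_PiE[of b a "b - m" f] by (simp add: parking_funs_iff_excess)
qed

text \<open>Equal excesses make \<open>b\<close> divide \<open>a * (x - y)\<close>, hence
  \<open>x - y\<close>, whose absolute value is less than \<open>b\<close>.\<close>

lemma excess_inj:
  assumes "coprime a b" "x < b" "y < b" "excess a b f x = excess a b f y"
  shows "x = y"
proof -
  have "int a * (int x - int y) = int b * (int (card {i \<in> {1..a}. f i < x}) -
          int (card {i \<in> {1..a}. f i < y}))"
    using assms(4) by (simp add: excess_def algebra_simps)
  then have "int b dvd int a * (int x - int y)" by simp
  then have "int b dvd int x - int y"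
    using assms(1) by (simp add: coprime_dvd_mult_right_iff coprime_commute)
  then have "int x mod int b = int y mod int b" by (simp add: mod_eq_dvd_iff)
  then show ?thesis using assms(2,3) by simp
qed

lemma card_invariant_funs_eq:
  assumes "b > 0" "coprime a b" "w permutes {1..a}"
  shows "card {f \<in> {1..a} \<rightarrow>\<^sub>E {..<b}. \<forall>i\<in>{1..a}. f (w i) = f i} =
         b * card {f \<in> parking_funs a b. \<forall>i\<in>{1..a}. f (w i) = f i}" (is "card ?F = b * card ?G")
proof -
  have w: "w i \<in> {1..a} \<longleftrightarrow> i \<in> {1..a}" for i by (rule permutes_in_image[OF assms(3)])
  have inv: "\<forall>i\<in>{1..a}. translate a b n f (w i) = translate a b n f i"
    if "\<forall>i\<in>{1..a}. f (w i) = f i" for n f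
    using that w by (auto simp: translate_def)
  have PiE: "g \<in> {1..a} \<rightarrow>\<^sub>E {..<b}" if "g \<in> parking_funs a b" for g
    using that by (simp add: parking_funs_def)
  have "bij_betw (\<lambda>(m, g). translate a b m g) ({..<b} \<times> ?G) ?F"
  proof (rule bij_betw_imageI)
    show "inj_on (\<lambda>(m, g). translate a b m g) ({..<b} \<times> ?G)"
    proof (rule inj_onI)
      fix P Q assume P: "P \<in> {..<b} \<times> ?G" and Q: "Q \<in> {..<b} \<times> ?G"
        and PQ: "(\<lambda>(m, g). translate a b m g) P = (\<lambda>(m, g). translate a b m g) Q"
      obtain m g m' g' where P_eq: "P = (m, g)" and Q_eq: "Q = (m', g')" by (meson surj_pair)
      have m: "m \<in> {..<b}" "m' \<in> {..<b}" and g: "g \<in> parking_funs a b" "g' \<in> parking_funs a b"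
        using P Q by (simp_all add: P_eq Q_eq)
      have eq: "translate a b m g = translate a b m' g'" using PQ by (simp add: P_eq Q_eq)
      define f where "f = translate a b m g"
      have f: "f \<in> {1..a} \<rightarrow>\<^sub>E {..<b}"
        unfolding f_def by (rule translate_PiE[OF assms(1)])
      have gf: "g = translate a b (b - m) f" "g' = translate a b (b - m') f"
        using m translate_translate[OF PiE[OF g(1)], of m "b - m"]
          translate_translate[OF PiE[OF g(2)], of m' "b - m'"]
        by (simp_all add: f_def eq)
      \<comment> \<open>Translating \<open>f\<close> back by either amount gives a parking function,
        so \<open>m\<close> and \<open>m'\<close> both minimize the excess of \<open>f\<close>. The
        shift is thus recovered from \<open>f\<close>.\<close>
      have "excess a b f m = excess a b f m'"
        using g m f unfolding gf by (intro antisym) (simp_all add: translate_parking_iff)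
      then have "m = m'" using excess_inj[OF assms(2)] m by blast
      with gf show "P = Q" by (simp add: P_eq Q_eq)
    qed
    show "(\<lambda>(m, g). translate a b m g) ` ({..<b} \<times> ?G) = ?F"
    proof (intro equalityI subsetI)
      fix f assume "f \<in> (\<lambda>(m, g). translate a b m g) ` ({..<b} \<times> ?G)"
      then show "f \<in> ?F" using translate_PiE[OF assms(1)] inv by auto
    next
      fix f assume f: "f \<in> ?F"
      obtain m where m: "m < b" "\<forall>y<b. excess a b f m \<le> excess a b f y"
        using arg_min_if_finite[of "{..<b}" "excess a b f"] assms(1)
        by (metis finite_lessThan lessThan_empty_iff lessThan_iff linorder_not_less not_gr_zero)
      then have "translate a b (b - m) f \<in> ?G"
        using f translate_parking_iff[of f a b m] inv by blast
      moreover have "translate a b m (translate a b (b - m) f) = f"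
        using f m by (intro translate_translate) auto
      ultimately show "f \<in> (\<lambda>(m, g). translate a b m g) ` ({..<b} \<times> ?G)"
        using m by (intro image_eqI[of _ _ "(m, translate a b (b - m) f)"]) auto
    qed
  qed
  then show ?thesis using bij_betw_same_card[of _ "{..<b} \<times> ?G" ?F] by (simp add: card_cartesian_product)
qed

section \<open>Functions constant on the cycles of a permutation\<close>

lemma invariant_on_orbit:
  assumes "w permutes A" "\<forall>i\<in>A. f (w i) = f i" "i \<in> A" "j \<in> orbit w i"
  shows "f j = f i"
proof -
  have "j \<in> A \<and> f j = f i"
    using assms(4) by induction (use assms(1-3) permutes_in_image[OF assms(1)] in auto)
  then show ?thesis ..
qed

lemma orbit_eq_if_permutes:
  assumes "w permutes A" "finite A" "j \<in> orbit w i"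
  shows "orbit w j = orbit w i"
proof -
  have "permutation w" using assms(1,2) permutation_permutes by blast
  then show ?thesis
    using assms(3) by (metis cyclic_on_orbit' orbit_cyclic_eq3)
qed

lemma card_invariant_funs:
  assumes "w permutes A" "finite A" "finite B"
  shows "card {f \<in> A \<rightarrow>\<^sub>E B. \<forall>i\<in>A. f (w i) = f i} = card B ^ num_cycles_on A w"
proof -
  have perm: "permutation w" using assms(1,2) permutation_permutes by blast
  have self: "i \<in> orbit w i" for i by (rule permutation_self_in_orbit[OF perm])
  have "bij_betw (\<lambda>h. restrict (\<lambda>i. h (orbit w i)) A) (orbit w ` A \<rightarrow>\<^sub>E B)
          {f \<in> A \<rightarrow>\<^sub>E B. \<forall>i\<in>A. f (w i) = f i}"
  proof (rule bij_betwI')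
    fix h h' assume h: "h \<in> orbit w ` A \<rightarrow>\<^sub>E B" "h' \<in> orbit w ` A \<rightarrow>\<^sub>E B"
    show "restrict (\<lambda>i. h (orbit w i)) A = restrict (\<lambda>i. h' (orbit w i)) A \<longleftrightarrow> h = h'"
    proof
      assume "restrict (\<lambda>i. h (orbit w i)) A = restrict (\<lambda>i. h' (orbit w i)) A"
      then have "h (orbit w i) = h' (orbit w i)" if "i \<in> A" for i
        using that by (metis restrict_apply')
      with h show "h = h'" by (intro PiE_ext) auto
    qed simp
  next
    fix h assume "h \<in> orbit w ` A \<rightarrow>\<^sub>E B"
    moreover have "orbit w (w i) = orbit w i" for i
      by (rule orbit_eq_if_permutes[OF assms(1,2) orbit.base])
    ultimately show "restrict (\<lambda>i. h (orbit w i)) A \<in> {f \<in> A \<rightarrow>\<^sub>E B. \<forall>i\<in>A. f (w i) = f i}"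
      using permutes_in_image[OF assms(1)] by auto
  next
    fix f assume f: "f \<in> {f \<in> A \<rightarrow>\<^sub>E B. \<forall>i\<in>A. f (w i) = f i}"
    \<comment> \<open>The chosen representative does not matter, because \<open>f\<close> is
      constant on each orbit.\<close>
    define h where "h = restrict (\<lambda>X. f (SOME i. i \<in> X)) (orbit w ` A)"
    have h: "h (orbit w i) = f i" if "i \<in> A" for i
    proof -
      have "(SOME j. j \<in> orbit w i) \<in> orbit w i" using self by (rule someI)
      then have "f (SOME j. j \<in> orbit w i) = f i"
        using f that by (intro invariant_on_orbit[OF assms(1)]) auto
      then show ?thesis using that by (simp add: h_def)
    qed
    have "h \<in> orbit w ` A \<rightarrow>\<^sub>E B"
    proof (rule PiE_I)
      show "h X \<in> B" if "X \<in> orbit w ` A" for X using that f h by auto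
    qed (simp add: h_def)
    moreover have "f = restrict (\<lambda>i. h (orbit w i)) A"
      using f h by (intro extensionalityI[of f A]) (auto simp: PiE_def)
    ultimately show "\<exists>h\<in>orbit w ` A \<rightarrow>\<^sub>E B. f = restrict (\<lambda>i. h (orbit w i)) A" by blast
  qed
  then have "card (orbit w ` A \<rightarrow>\<^sub>E B) = card {f \<in> A \<rightarrow>\<^sub>E B. \<forall>i\<in>A. f (w i) = f i}"
    by (rule bij_betw_same_card)
  then show ?thesis using assms(2) by (simp add: card_PiE num_cycles_on_def)
qed

theorem corollary4:
  fixes a b :: nat
  assumes "a > 0" and "b > 0" and "coprime a b"
  shows "(\<forall>w k. w permutes {1..a} \<and> num_cycles_on {1..a} w = k \<longrightarrow>
            card {P \<in> parking_functions a b. parking_act w P = P} = b ^ (k - 1)) \<and>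
         card (parking_functions a b) = b ^ (a - 1)"
proof -
  have main: "card {P \<in> parking_functions a b. parking_act w P = P} =
      b ^ (num_cycles_on {1..a} w - 1)" if w: "w permutes {1..a}" for w
  proof -
    \<comment> \<open>With at least one cycle, a factor \<open>b\<close> can be cancelled from
      \<open>b ^ num_cycles_on {1..a} w\<close>.\<close>
    have "num_cycles_on {1..a} w > 0"
      using assms(1) by (auto simp: num_cycles_on_def card_gt_0_iff)
    moreover have "b * card {P \<in> parking_functions a b. parking_act w P = P} =
        b ^ num_cycles_on {1..a} w"
      unfolding card_fixed_parking_functions[OF assms(2) w]
        card_invariant_funs_eq[OF assms(2,3) w, symmetric]
        card_invariant_funs[OF w finite_atLeastAtMost finite_lessThan]
      by simp
    ultimately show ?thesis using assms(2) by (simp add: power_eq_if)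
  qed
  \<comment> \<open>The total count is the case of the identity, whose \<open>a\<close> cycles are
    single points. Its action still re-sorts, which changes nothing on a parking function.\<close>
  have "parking_act id P = P" if "P \<in> parking_functions a b" for P
  proof -
    obtain p l where P: "P = (p, l)" by fastforce
    with that obtain f where "map f l = north_columns p" "l = sort_key f (sorted_list_of_set {1..a})"
      "distinct l" "set l = {1..a}"
      unfolding P parking_functions_iff[OF assms(2)] by blast
    then show ?thesis
      using parking_act_fixed_iff[OF permutes_id, of l a f p] P by simp
  qed
  then have all: "{P \<in> parking_functions a b. parking_act id P = P} = parking_functions a b"
    by blast
  have "orbit id i = {i}" for i :: nat
    using orbit_eq_singleton_iff[of id i] by simp
  then have "num_cycles_on {1..a} id = a"
    by (simp add: num_cycles_on_def card_image)
  with main[OF permutes_id] all have "card (parking_functions a b) = b ^ (a - 1)"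
    by simp
  with main show ?thesis by blast
qed

end
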